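(* The algorithm Serial-parser, run with $m=\frac{1}{\epsilon}\left(nv\ln 2+\ln\frac1\delta\right)$ training examples, is a speedup learning algorithm for $\mathcal{M}_\Omega$ in $\mathcal{H}_\Omega$, if 1. all domains in the meta-domain $\mathcal{M}_\Omega$ are serially decomposable with respect to the feature ordering $\Omega$; 2. $\mathcal{H}_\Omega$ is the set of all problem solvers based on nonredundant macro-tables with the feature ordering $\Omega$ for domains in $\mathcal{M}_\Omega$; and 3. the number $v$ of distinct feature values is bounded by a polynomial function of the maximum problem size $n$.
   Context: **Domains.** A problem domain $D$ is a tuple $\langle S,G,O\rangle$, where $S$ is a set of states, $G$ is a procedure recognizing the goal states, and $O=\{o_1,\dots,o_l\}$ is a set of operators, each a procedure mapping a state in $S$ to a state in $S$. The specification of $D$ is the combination of its goals and operators (given as procedures that can be called). A meta-domain is a set of domains over the same set of states. A problem is a state. A problem $s$ is solvable if there are operators $o_{x_1},\dots,o_{x_d}$ and states $s_0=s,\ s_i=o_{x_i}(s_{i-1})$ with $s_d$ a goal state; then $(o_{x_1},\dots,o_{x_d})$ is a solution sequence of $s$, of length $d$. A problem solver for a domain is a deterministic program that takes a problem as input and outputs a solution sequence of it, or the special symbol $\perp$ if it finds none. A hypothesis space is a set of problem solvers. **Features.** Here states are vectors $s=\langle s^1,\dots,s^n\rangle$ of $n$ discrete-valued features, each feature taking at most $v$ values; $n$ serves as the problem size. There is a single goal state $g=\langle g^1,\dots,g^n\rangle$, known from the domain specification. $\Omega$ is a fixed total ordering of the features, known to the learner; the features are numbered $1,\dots,n$ according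 to $\Omega$. A domain is serially decomposable with respect to $\Omega$ if the effect of any operator on a feature value is a function of the values of only that feature and the features preceding it in $\Omega$. **Macro-tables.** A macro is a finite (possibly empty) sequence of operators. A macro table has an entry $M_{j,i}$ for each feature $i$ (column) and each possible value $j$ of it (row). A macro $M_{j,i}$ satisfies the macro-table property if whenever it is applied in a solvable state in which features $1,\dots,i-1$ have their goal values $g^1,\dots,g^{i-1}$ and feature $i$ has value $j$, features $1,\dots,i$ of the resulting state have the goal values $g^1,\dots,g^i$. A macro $M_{j,i}$ is nonredundant if it satisfies the macro-table property and no strict prefix of it does. A macro table is nonredundant if it contains only nonredundant macros. **Macro-problem-solver.** With macro table $M$ and input state $s$: start with the empty solution; for $i=1,\dots,n$, let $j=s^i$, append $M_{j,i}$ to the solution and replace $s$ by the result of applying $M_{j,i}$ to $s$; output the solution. If a needed entry is missing, or the final state is not the goal state, the output is taken to be $\perp$. A problem solver for $D$ is based on a macro-table $M$ with feature ordering $\Omega$ if $D$ is serially decomposable with respect to $\Omega$ and it constructs its solutions by running Macro-problem-solver on $M$ with ordering $\Omega$. **Oracle.** For a target problem solver $f$ for $D$ and a probability distribution $P$ on the problems, each call to SOLVED-PROBLEM draws $x$ independently with probability $P(x)$ and returns the training example $\langle x,f(x)\rangle$ ($\langle x,\perp\rangle$ if $f$ does not solve $x$). **Serial-parser.** Input: $\epsilon,\delta,D,n,v$. Start with all table entries $M_{j,i}$ empty (unfilled). Repeat $m$ times ($m$ rounded up to an integer): call SOLVED-PROBLEM to obtain $(x_0,\sigma)$; if $\sigma=\perp$,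 continue with the next iteration; otherwise let $\sigma=o_{x_1},\dots,o_{x_r}$ and compute the states $x_k=o_{x_k}(x_{k-1})$ for $k=1,\dots,r$. Set $p:=0$. For $i=1,\dots,n$: let $j:=x_p^i$ (value of feature $i$ in state $x_p$); let $k\ge p$ be the smallest integer such that $\langle x_k^1,\dots,x_k^i\rangle=\langle g^1,\dots,g^i\rangle$; if $M_{j,i}$ is unfilled, set $M_{j,i}:=o_{x_{p+1}},o_{x_{p+2}},\dots,o_{x_k}$; set $p:=k$. Finally output the macro table $M$, i.e. the problem solver that runs Macro-problem-solver on $M$. **Speedup learning algorithm.** An algorithm $A$ is a speedup learning algorithm for a meta-domain $\mathcal{M}$ in a hypothesis space $\mathcal{F}$ if for any domain $D\in\mathcal{M}$, any problem distribution $P$ and any target problem solver $f\in\mathcal{F}$ for $D$: (1) $A$ takes as input the specification of $D$, a maximum problem size $n$ (here also $v$), an error parameter $\epsilon$ and a confidence parameter $\delta$ (with $0<\epsilon,\delta<1$); (2) $A$ may call SOLVED-PROBLEM, which returns examples $\langle x,f(x)\rangle$ with $x$ chosen with probability $P(x)$ from the problem set; the number of oracle calls is polynomial in $n,\frac1\epsilon,\frac1\delta$ and the length of its input; its running time is polynomial in all the previous parameters and an upper bound $t$ on the running times of the programs (goal and operators) in $D$ on inputs of size $n$ (the length of the input includes the lengths of the examples received from the oracle); (3) for all $D\in\mathcal{M}$ and all probability distributions $P$ over the problem set, with probability at least $1-\delta$, $A$ outputs a program $f'$ that approximates $f$ in the sense that $\sum_{x\in\Delta}P(x)\le\epsilon$,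 where $\Delta=\{x\mid f'(x)\ne f(x)\text{ and }f(x)\ne\perp\}$; (4) there is a fixed polynomial $R$ such that, with $L$ the maximum solution length (the maximum length of a solution output by the target $f$ on problems of size at most $n$), if $A$ outputs $f'$ then the run time of $f'$ is bounded by $R(n,L,t,\frac1\epsilon,\frac1\delta)$. *)

theory Defs
  imports "HOL-Probability.Probability" "HOL-Library.Sublist" "HOL-Library.Monad_Syntax"
begin

section \<open>Domains, problems and solutions\<close>

text \<open>
  A state is the list of its feature values, listed in the order \<open>\<Omega>\<close>; so \<open>\<Omega>\<close> is the order of the
  list positions. Positions are counted from 0: the feature numbered \<open>i + 1\<close> of \<open>s\<close> is \<open>s ! i\<close>.
  Operators are named by the numbers below \<open>num_ops\<close>. A procedure of a domain is given by its
  result together with its running time on each argument.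
\<close>

type_synonym state = "nat list"
type_synonym operator = nat
type_synonym macro = "operator list"

record domain =
  states :: "state set"
  goal_state :: state
  goal_proc :: "state \<Rightarrow> bool \<times> nat"
  num_ops :: nat
  op_proc :: "operator \<Rightarrow> state \<Rightarrow> state \<times> nat"

definition is_goal :: "domain \<Rightarrow> state \<Rightarrow> bool" where
  "is_goal D s = fst (goal_proc D s)"

definition apply_op :: "domain \<Rightarrow> operator \<Rightarrow> state \<Rightarrow> state" where
  "apply_op D a s = fst (op_proc D a s)"

definition apply_ops :: "domain \<Rightarrow> operator list \<Rightarrow> state \<Rightarrow> state" where
  "apply_ops D = fold (apply_op D)"

definition solution_sequence :: "domain \<Rightarrow> state \<Rightarrow> operator list \<Rightarrow> bool" where
  "solution_sequence D s \<sigma> \<longleftrightarrow> set \<sigma> \<subseteq> {..<num_ops D} \<and> is_goal D (apply_ops D \<sigma> s)"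

definition solvable :: "domain \<Rightarrow> state \<Rightarrow> bool" where
  "solvable D s \<longleftrightarrow> (\<exists>\<sigma>. solution_sequence D s \<sigma>)"

definition feature_values :: "domain \<Rightarrow> nat \<Rightarrow> nat set" where
  "feature_values D i = (\<lambda>s. s ! i) ` states D"

text \<open>The state set need not contain every combination of feature values.\<close>

definition feature_domain :: "nat \<Rightarrow> nat \<Rightarrow> domain \<Rightarrow> bool" where
  "feature_domain n v D \<longleftrightarrow>
     (\<forall>s\<in>states D. length s = n) \<and>
     (\<forall>i<n. finite (feature_values D i) \<and> card (feature_values D i) \<le> v) \<and>
     goal_state D \<in> states D \<and>
     (\<forall>s\<in>states D. is_goal D s \<longleftrightarrow> s = goal_state D) \<and>
     (\<forall>a<num_ops D. \<forall>s\<in>states D. apply_op D a s \<in> states D)"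

definition meta_domain :: "nat \<Rightarrow> nat \<Rightarrow> domain set \<Rightarrow> bool" where
  "meta_domain n v M \<longleftrightarrow>
     (\<forall>D\<in>M. feature_domain n v D) \<and> (\<exists>S. \<forall>D\<in>M. states D = S)"

definition serially_decomposable :: "nat \<Rightarrow> domain \<Rightarrow> bool" where
  "serially_decomposable n D \<longleftrightarrow>
     (\<forall>a<num_ops D. \<forall>i<n. \<exists>h. \<forall>s\<in>states D. apply_op D a s ! i = h (take (Suc i) s))"

definition time_bound :: "domain \<Rightarrow> nat \<Rightarrow> bool" where
  "time_bound D t \<longleftrightarrow>
     (\<forall>s\<in>states D. snd (goal_proc D s) \<le> t \<and> (\<forall>a<num_ops D. snd (op_proc D a s) \<le> t))"


section \<open>Programs and their running time\<close>

text \<open>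
  A deterministic program sees the procedures of the domain only by calling them. \<open>Step\<close> is one
  elementary machine operation (access to a variable, list cell or vector component, comparison,
  arithmetic, loop test) and costs 1; a call costs 1 plus the running time of the procedure.
\<close>

datatype 'a prog =
    Return 'a
  | Step "'a prog"
  | CallOp operator state "state \<Rightarrow> 'a prog"
  | CallGoal state "bool \<Rightarrow> 'a prog"

primrec exec :: "domain \<Rightarrow> 'a prog \<Rightarrow> 'a \<times> nat" where
  "exec D (Return a) = (a, 0)"
| "exec D (Step p) = (let (a, c) = exec D p in (a, Suc c))"
| "exec D (CallOp o1 s k) =
     (let (a, c) = exec D (k (fst (op_proc D o1 s))) in (a, Suc (snd (op_proc D o1 s) + c)))"
| "exec D (CallGoal s k) =
     (let (a, c) = exec D (k (fst (goal_proc D s))) in (a, Suc (snd (goal_proc D s) + c)))"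

primrec bind_prog :: "'a prog \<Rightarrow> ('a \<Rightarrow> 'b prog) \<Rightarrow> 'b prog" where
  "bind_prog (Return a) f = f a"
| "bind_prog (Step p) f = Step (bind_prog p f)"
| "bind_prog (CallOp o1 s k) f = CallOp o1 s (\<lambda>s'. bind_prog (k s') f)"
| "bind_prog (CallGoal s k) f = CallGoal s (\<lambda>b. bind_prog (k b) f)"

adhoc_overloading Monad_Syntax.bind \<rightleftharpoons> bind_prog

definition tick :: "unit prog" where
  "tick = Step (Return ())"

definition call_op :: "operator \<Rightarrow> state \<Rightarrow> state prog" where
  "call_op a s = CallOp a s Return"

definition call_goal :: "state \<Rightarrow> bool prog" where
  "call_goal s = CallGoal s Return"

text \<open>The output \<open>None\<close> of a solver stands for \<open>\<bottom>\<close>.\<close>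

type_synonym solver = "state \<Rightarrow> operator list option prog"

definition answer :: "domain \<Rightarrow> solver \<Rightarrow> state \<Rightarrow> operator list option" where
  "answer D f s = fst (exec D (f s))"

definition run_time :: "domain \<Rightarrow> solver \<Rightarrow> state \<Rightarrow> nat" where
  "run_time D f s = snd (exec D (f s))"

definition problem_solver :: "domain \<Rightarrow> solver \<Rightarrow> bool" where
  "problem_solver D f \<longleftrightarrow>
     (\<forall>s\<in>states D. \<forall>\<sigma>. answer D f s = Some \<sigma> \<longrightarrow> solution_sequence D s \<sigma>)"


section \<open>Learning programs\<close>

text \<open>
  A learning program alternates local computation with calls of SOLVED-PROBLEM. It is run on the
  distribution \<open>E\<close> of a single example; each call draws independently.
\<close>

type_synonym example = "state \<times> operator list option"

datatype 'a learner =
    Output 'a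
  | Local "'a learner prog"
  | Sample "example \<Rightarrow> 'a learner"

record 'a outcome =
  result :: 'a
  calls :: nat
  time :: nat
  received :: nat  \<comment> \<open>total length of the examples received\<close>

fun example_length :: "example \<Rightarrow> nat" where
  "example_length (x, None) = length x + 1"
| "example_length (x, Some \<sigma>) = length x + length \<sigma> + 1"

primrec run :: "domain \<Rightarrow> example pmf \<Rightarrow> 'a learner \<Rightarrow> 'a outcome pmf" where
  "run D E (Output a) = return_pmf \<lparr>result = a, calls = 0, time = 0, received = 0\<rparr>"
| "run D E (Local p) =
     (let (q, c) = exec D (map_prog (run D E) p) in map_pmf (time_update (\<lambda>t. t + c)) q)"
| "run D E (Sample k) =
     bind_pmf E (\<lambda>e. map_pmf (calls_update Suc \<circ> time_update Suc
                               \<circ> received_update (\<lambda>l. l + example_length e)) (run D E (k e)))"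

definition solved_problem :: "domain \<Rightarrow> state pmf \<Rightarrow> solver \<Rightarrow> example pmf" where
  "solved_problem D P f = map_pmf (\<lambda>x. (x, answer D f x)) P"

text \<open>
  The arguments of a learning algorithm: the number of operators and the goal state (with the
  procedures available through calls, this is the specification of the domain), then
  \<open>n\<close>, \<open>v\<close>, \<open>\<epsilon>\<close>, \<open>\<delta>\<close>. Its initial input has length \<open>input_length\<close>: one unit for each operator, each
  component of the goal state, the goal procedure and the four numbers.
\<close>

type_synonym learning_algorithm =
  "nat \<Rightarrow> state \<Rightarrow> nat \<Rightarrow> nat \<Rightarrow> real \<Rightarrow> real \<Rightarrow> solver learner"

definition input_length :: "domain \<Rightarrow> nat" where
  "input_length D = num_ops D + length (goal_state D) + 5"


section \<open>Speedup learning\<close>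

definition max_solution_length :: "domain \<Rightarrow> solver \<Rightarrow> nat" where
  "max_solution_length D f =
     Max (insert 0 {length \<sigma> | s \<sigma>. s \<in> states D \<and> answer D f s = Some \<sigma>})"

definition disagreement :: "domain \<Rightarrow> solver \<Rightarrow> solver \<Rightarrow> state set" where
  "disagreement D f f' =
     {x \<in> states D. answer D f' x \<noteq> answer D f x \<and> answer D f x \<noteq> None}"

definition approximates :: "domain \<Rightarrow> state pmf \<Rightarrow> real \<Rightarrow> solver \<Rightarrow> solver \<Rightarrow> bool" where
  "approximates D P \<epsilon> f f' \<longleftrightarrow> (\<Sum>x\<in>disagreement D f f'. pmf P x) \<le> \<epsilon>"

text \<open>
  \<open>M n\<close> is the meta-domain at problem size \<open>n\<close>, \<open>v n\<close> the bound on the number of feature values there,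
  and \<open>(D, f) \<in> F n\<close> says that \<open>f\<close> is a solver for \<open>D\<close> in the hypothesis space. The three polynomials
  bound the number of oracle calls (\<open>C\<close>), the running time of the algorithm (\<open>T\<close>) and the running time of
  its output (\<open>R\<close>); they do not depend on the problem size. Only in \<open>T\<close> does the input length include
  the examples received: in \<open>C\<close> this would make the requirement vacuous.
\<close>

definition speedup_learning_algorithm ::
  "learning_algorithm \<Rightarrow> (nat \<Rightarrow> nat) \<Rightarrow> (nat \<Rightarrow> domain set) \<Rightarrow> (nat \<Rightarrow> (domain \<times> solver) set) \<Rightarrow> bool"
where
  "speedup_learning_algorithm A v M F \<longleftrightarrow>
    (\<exists>C T R. real_polynomial_function C \<and> real_polynomial_function T \<and> real_polynomial_function R \<and>
      (\<forall>n. \<forall>D\<in>M n. \<forall>P f \<epsilon> \<delta>.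
        set_pmf P \<subseteq> states D \<longrightarrow> (D, f) \<in> F n \<longrightarrow>
        0 < \<epsilon> \<longrightarrow> \<epsilon> < 1 \<longrightarrow> 0 < \<delta> \<longrightarrow> \<delta> < 1 \<longrightarrow>
        (let runs = run D (solved_problem D P f) (A (num_ops D) (goal_state D) n (v n) \<epsilon> \<delta>);
             L = max_solution_length D f
         in (\<forall>w\<in>set_pmf runs. real (calls w) \<le> C (real n, 1 / \<epsilon>, 1 / \<delta>, real (input_length D))) \<and>
            (\<forall>t. time_bound D t \<longrightarrow> (\<forall>w\<in>set_pmf runs.
               real (time w)
                 \<le> T (real n, 1 / \<epsilon>, 1 / \<delta>, real (input_length D + received w), real t))) \<and>
            measure_pmf.prob runs {w. approximates D P \<epsilon> f (result w)} \<ge> 1 - \<delta> \<and>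
            (\<forall>t. time_bound D t \<longrightarrow> (\<forall>w\<in>set_pmf runs. \<forall>x\<in>states D.
               real (run_time D (result w) x)
                 \<le> R (real n, real L, real t, 1 / \<epsilon>, 1 / \<delta>))))))"


section \<open>Macro tables\<close>

text \<open>
  The entry in row \<open>j\<close> (feature value) and column \<open>i\<close> (feature) is stored under the key \<open>(j, i)\<close>.
  Entries may be unfilled.
\<close>

type_synonym macro_table = "((nat \<times> nat) \<times> macro) list"

abbreviation entry :: "macro_table \<Rightarrow> nat \<Rightarrow> nat \<Rightarrow> macro option" where
  "entry tab j i \<equiv> map_of tab (j, i)"

definition macro_table_property :: "domain \<Rightarrow> nat \<Rightarrow> nat \<Rightarrow> macro \<Rightarrow> bool" where
  "macro_table_property D j i mac \<longleftrightarrow>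
     (\<forall>s\<in>states D. solvable D s \<and> (\<forall>k<i. s ! k = goal_state D ! k) \<and> s ! i = j \<longrightarrow>
        (\<forall>k\<le>i. apply_ops D mac s ! k = goal_state D ! k))"

definition nonredundant_macro :: "domain \<Rightarrow> nat \<Rightarrow> nat \<Rightarrow> macro \<Rightarrow> bool" where
  "nonredundant_macro D j i mac \<longleftrightarrow>
     macro_table_property D j i mac \<and>
     (\<forall>mac'. strict_prefix mac' mac \<longrightarrow> \<not> macro_table_property D j i mac')"

definition nonredundant_table :: "domain \<Rightarrow> nat \<Rightarrow> macro_table \<Rightarrow> bool" where
  "nonredundant_table D n tab \<longleftrightarrow>
     (\<forall>i<n. \<forall>j\<in>feature_values D i. \<forall>mac. entry tab j i = Some mac \<longrightarrow>
        set mac \<subseteq> {..<num_ops D} \<and> nonredundant_macro D j i mac)"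


section \<open>Macro-problem-solver\<close>

primrec lookup_entry :: "macro_table \<Rightarrow> nat \<Rightarrow> nat \<Rightarrow> macro option prog" where
  "lookup_entry [] j i = do { tick; Return None }"
| "lookup_entry (e # tab) j i =
     do { tick; if fst e = (j, i) then Return (Some (snd e)) else lookup_entry tab j i }"

primrec append_prog :: "'a list \<Rightarrow> 'a list \<Rightarrow> 'a list prog" where
  "append_prog [] ys = do { tick; Return ys }"
| "append_prog (x # xs) ys = do { tick; zs \<leftarrow> append_prog xs ys; tick; Return (x # zs) }"

primrec apply_macro :: "macro \<Rightarrow> state \<Rightarrow> state prog" where
  "apply_macro [] s = do { tick; Return s }"
| "apply_macro (a # mac) s = do { tick; s' \<leftarrow> call_op a s; apply_macro mac s' }"

primrec solve_features ::
  "macro_table \<Rightarrow> nat list \<Rightarrow> state \<Rightarrow> operator list \<Rightarrow> operator list option prog" where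
  "solve_features tab [] s sol =
     do { tick; b \<leftarrow> call_goal s; tick; Return (if b then Some sol else None) }"
| "solve_features tab (i # is) s sol =
     do { tick;
          e \<leftarrow> (do { tick; lookup_entry tab (s ! i) i });
          tick;
          case e of
            None \<Rightarrow> Return None
          | Some mac \<Rightarrow> do { sol' \<leftarrow> append_prog sol mac;
                            s' \<leftarrow> apply_macro mac s;
                            solve_features tab is s' sol' } }"

definition macro_problem_solver :: "nat \<Rightarrow> macro_table \<Rightarrow> solver" where
  "macro_problem_solver n tab s = solve_features tab [0..<n] s []"

definition based_on :: "domain \<Rightarrow> nat \<Rightarrow> macro_table \<Rightarrow> solver \<Rightarrow> bool" where
  "based_on D n tab f \<longleftrightarrow> serially_decomposable n D \<and> f = macro_problem_solver n tab"

definition nonredundant_macro_solvers :: "nat \<Rightarrow> domain set \<Rightarrow> (domain \<times> solver) set" where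
  "nonredundant_macro_solvers n M =
     {(D, f). D \<in> M \<and> problem_solver D f \<and> (\<exists>tab. nonredundant_table D n tab \<and> based_on D n tab f)}"


section \<open>Serial-parser\<close>

text \<open>\<open>agree s g i\<close> tests whether \<open>s\<close> and \<open>g\<close> have the same values of the first \<open>i\<close> features.\<close>

primrec agree :: "state \<Rightarrow> state \<Rightarrow> nat \<Rightarrow> bool prog" where
  "agree s g 0 = do { tick; Return True }"
| "agree s g (Suc i) = do { tick; if s ! i = g ! i then agree s g i else Return False }"

primrec trajectory :: "state \<Rightarrow> operator list \<Rightarrow> state list prog" where
  "trajectory s [] = do { tick; Return [s] }"
| "trajectory s (a # \<sigma>) =
     do { tick; s' \<leftarrow> call_op a s; xs \<leftarrow> trajectory s' \<sigma>; tick; Return (s # xs) }"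

text \<open>
  The position \<open>p\<close> in the trajectory is represented by the remaining states \<open>x\<^sub>p, \<dots>, x\<^sub>r\<close> and the
  remaining operators. \<open>next_segment g i\<close> moves from \<open>p\<close> to the least \<open>k \<ge> p\<close> for which \<open>x\<^sub>k\<close> and
  \<open>g\<close> agree on the first \<open>i\<close> features; it returns the operators passed over and the representation
  of \<open>k\<close>. It never runs past the final state, which for a solution is \<open>g\<close>.
\<close>

fun next_segment ::
  "state \<Rightarrow> nat \<Rightarrow> state list \<Rightarrow> operator list \<Rightarrow> (macro \<times> state list \<times> operator list) prog"
where
  "next_segment g i (x # xs) (a # \<sigma>) =
     do { b \<leftarrow> agree x g i;
          tick;
          if b then Return ([], x # xs, a # \<sigma>)
          else do { (mac, rest) \<leftarrow> next_segment g i xs \<sigma>; tick; Return (a # mac, rest) } }"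
| "next_segment g i xs \<sigma> = do { tick; Return ([], xs, \<sigma>) }"

primrec parse_features ::
  "state \<Rightarrow> nat list \<Rightarrow> state list \<Rightarrow> operator list \<Rightarrow> macro_table \<Rightarrow> macro_table prog" where
  "parse_features g [] xs \<sigma> tab = do { tick; Return tab }"
| "parse_features g (i # is) xs \<sigma> tab =
     do { tick;
          j \<leftarrow> (do { tick; Return (hd xs ! i) });
          (mac, xs', \<sigma>') \<leftarrow> next_segment g (Suc i) xs \<sigma>;
          e \<leftarrow> lookup_entry tab j i;
          tick;
          parse_features g is xs' \<sigma>' (case e of None \<Rightarrow> ((j, i), mac) # tab | Some _ \<Rightarrow> tab) }"

primrec parse_examples :: "nat \<Rightarrow> state \<Rightarrow> nat \<Rightarrow> macro_table \<Rightarrow> macro_table learner" where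
  "parse_examples n g 0 = (\<lambda>tab. Local (do { tick; Return (Output tab) }))"
| "parse_examples n g (Suc m) = (\<lambda>tab. Sample (\<lambda>(x, r). Local (do {
     tick;
     case r of
       None \<Rightarrow> Return (parse_examples n g m tab)
     | Some \<sigma> \<Rightarrow> do { xs \<leftarrow> trajectory x \<sigma>;
                     tab' \<leftarrow> parse_features g [0..<n] xs \<sigma> tab;
                     Return (parse_examples n g m tab') } })))"

definition sample_size :: "nat \<Rightarrow> nat \<Rightarrow> real \<Rightarrow> real \<Rightarrow> nat" where
  "sample_size n v \<epsilon> \<delta> = nat \<lceil>1 / \<epsilon> * (real n * real v * ln 2 + ln (1 / \<delta>))\<rceil>"

text \<open>The computation of the sample size is charged as a constant number of operations.\<close>

definition serial_parser :: learning_algorithm where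
  "serial_parser l g n v \<epsilon> \<delta> =
     Local (do { tick;
                 Return (map_learner (macro_problem_solver n)
                           (parse_examples n g (sample_size n v \<epsilon> \<delta>) [])) })"

end

theory Submission
  imports Defs
begin

text \<open>
  By serial decomposability and nonredundancy, the least position at which the parser finds the
  first \<open>i\<close> features at their goal values is exactly the end of the macro that the target used for
  feature \<open>i\<close>. So the learned table is always the restriction of the target table to the set of
  entries used on the solved examples seen so far, and it reproduces the target's answer on a solved
  problem exactly if it contains all the entries used there. A set of entries whose restriction has
  error above \<open>\<epsilon>\<close> survives \<open>m\<close> examples with probability at most \<open>(1 - \<epsilon>)\<^sup>m\<close>, and there are at most
  \<open>2\<close> to the power \<open>n v\<close> such sets; a union bound gives the sample size. Every learned macro is a
  segment of a target solution, which bounds the running time of the learned solver.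
\<close>

section \<open>Execution of programs\<close>

abbreviation val :: "domain \<Rightarrow> 'a prog \<Rightarrow> 'a" where
  "val D p \<equiv> fst (exec D p)"

abbreviation cost :: "domain \<Rightarrow> 'a prog \<Rightarrow> nat" where
  "cost D p \<equiv> snd (exec D p)"

lemma val_simps [simp]:
  "val D (Step p) = val D p"
  "val D (CallOp a s k) = val D (k (apply_op D a s))"
  "val D (CallGoal s h) = val D (h (is_goal D s))"
  by (simp_all add: Let_def case_prod_unfold apply_op_def is_goal_def)

lemma cost_simps [simp]:
  "cost D (Step p) = Suc (cost D p)"
  "cost D (CallOp a s k) = Suc (snd (op_proc D a s) + cost D (k (apply_op D a s)))"
  "cost D (CallGoal s h) = Suc (snd (goal_proc D s) + cost D (h (is_goal D s)))"
  by (simp_all add: Let_def case_prod_unfold apply_op_def is_goal_def)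

declare exec.simps(2-4) [simp del]

lemma val_bind [simp]: "val D (bind_prog p f) = val D (f (val D p))"
  by (induction p) auto

lemma cost_bind [simp]: "cost D (bind_prog p f) = cost D p + cost D (f (val D p))"
  by (induction p) auto

lemma val_basic [simp]:
  "val D tick = ()" "val D (call_op a s) = apply_op D a s" "val D (call_goal s) = is_goal D s"
  by (simp_all add: tick_def call_op_def call_goal_def)

lemma cost_basic [simp]:
  "cost D tick = 1" "cost D (call_op a s) = Suc (snd (op_proc D a s))"
  "cost D (call_goal s) = Suc (snd (goal_proc D s))"
  by (simp_all add: tick_def call_op_def call_goal_def)

lemma exec_map_prog: "exec D (map_prog h p) = (h (val D p), cost D p)"
  by (induction p) (auto simp: prod_eq_iff)

text \<open>Structural induction on learners gives its hypothesis at a \<open>Local\<close> node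
  only for members of \<open>set_prog p\<close>; this makes it available for the learner that
  \<open>p\<close> actually returns.\<close>

lemma val_in_set_prog: "val D p \<in> set_prog p"
  by (induction p) auto

lemma apply_ops_simps [simp]:
  "apply_ops D [] s = s"
  "apply_ops D (a # \<sigma>) s = apply_ops D \<sigma> (apply_op D a s)"
  "apply_ops D (\<sigma> @ \<tau>) s = apply_ops D \<tau> (apply_ops D \<sigma> s)"
  by (simp_all add: apply_ops_def)

lemma val_lookup_entry [simp]: "val D (lookup_entry tab j i) = entry tab j i"
  by (induction tab) auto

lemma cost_lookup_entry: "cost D (lookup_entry tab j i) \<le> Suc (length tab)"
  by (induction tab) auto

lemma val_append_prog [simp]: "val D (append_prog xs ys) = xs @ ys"
  by (induction xs) auto

lemma cost_append_prog [simp]: "cost D (append_prog xs ys) = 2 * length xs + 1"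
  by (induction xs) auto

lemma val_apply_macro [simp]: "val D (apply_macro mac s) = apply_ops D mac s"
  by (induction mac arbitrary: s) auto

lemma val_agree [simp]: "val D (agree s g i) \<longleftrightarrow> (\<forall>k<i. s ! k = g ! k)"
  by (induction i) (auto simp: less_Suc_eq)

lemma cost_agree: "cost D (agree s g i) \<le> Suc i"
  by (induction i) auto

section \<open>Cost of parsing one solution\<close>

lemma cost_next_segment:
  "cost D (next_segment g i xs \<sigma>) \<le> length \<sigma> * (i + 3) + 1 + i"
proof (induction g i xs \<sigma> rule: next_segment.induct)
  case (1 g i x xs a \<sigma>)
  \<comment> \<open>Passing over one operator costs at most \<open>i + 1\<close> for the comparison
    and two ticks, hence the factor \<open>i + 3\<close>.\<close>
  show ?case
    using "1.IH"[of "val D (agree x g i)"] cost_agree[of D x g i]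
    by (cases "val D (agree x g i)") (simp_all add: case_prod_unfold algebra_simps del: val_agree)
qed auto

lemma length_next_segment:
  "length (snd (snd (val D (next_segment g i xs \<sigma>)))) \<le> length \<sigma>"
  by (induction g i xs \<sigma> rule: next_segment.induct) (auto simp: case_prod_unfold le_Suc_eq)

lemma length_parse_features:
  "length (val D (parse_features g js xs \<sigma> tab)) \<le> length tab + length js"
proof (induction js arbitrary: xs \<sigma> tab)
  case (Cons i js)
  show ?case
    by (auto simp: case_prod_unfold split: option.split intro: order_trans[OF Cons.IH])
qed simp

lemma cost_parse_features:
  assumes "\<forall>i\<in>set js. i < n"
  shows "cost D (parse_features g js xs \<sigma> tab)
    \<le> length js * (length \<sigma> * (n + 3) + length tab + length js + n + 6) + 1"
  using assms
proof (induction js arbitrary: xs \<sigma> tab)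
  case (Cons i js)
  define \<sigma>' where "\<sigma>' = snd (snd (val D (next_segment g (Suc i) xs \<sigma>)))"
  define xs' where "xs' = fst (snd (val D (next_segment g (Suc i) xs \<sigma>)))"
  define tab' where "tab' = (case entry tab (hd xs ! i) i of None \<Rightarrow>
     ((hd xs ! i, i), fst (val D (next_segment g (Suc i) xs \<sigma>))) # tab | Some _ \<Rightarrow> tab)"
  have "i < n" using Cons.prems by simp
  have \<sigma>': "length \<sigma>' \<le> length \<sigma>"
    unfolding \<sigma>'_def by (rule length_next_segment)
  have tab': "length tab' \<le> length tab + 1"
    by (auto simp: tab'_def split: option.split)
  have "cost D (parse_features g js xs' \<sigma>' tab')
     \<le> length js * (length \<sigma>' * (n + 3) + length tab' + length js + n + 6) + 1"
    using Cons by simp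
  \<comment> \<open>The table gains at most one entry at feature \<open>i\<close>; the summand
    \<open>length js\<close>, one smaller in the recursive call, absorbs it.\<close>
  also have "\<dots> \<le> length js * (length \<sigma> * (n + 3) + length tab + length (i # js) + n + 6) + 1"
    using tab' mult_le_mono1[OF \<sigma>', of "n + 3"] list.size(4)[of i js]
    by (intro add_right_mono mult_le_mono2) linarith
  finally have 1: "cost D (parse_features g js xs' \<sigma>' tab') \<le> \<dots>" .
  have "cost D (next_segment g (Suc i) xs \<sigma>) \<le> length \<sigma> * (Suc i + 3) + 1 + Suc i"
    by (rule cost_next_segment)
  also have "\<dots> \<le> length \<sigma> * (n + 3) + 1 + n"
    using \<open>i < n\<close> by (intro add_mono mult_le_mono) simp_all
  finally have 2: "cost D (next_segment g (Suc i) xs \<sigma>) \<le> \<dots>" .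
  have "cost D (parse_features g (i # js) xs \<sigma> tab) =
    3 + cost D (next_segment g (Suc i) xs \<sigma>) + cost D (lookup_entry tab (hd xs ! i) i)
      + cost D (parse_features g js xs' \<sigma>' tab')"
    by (simp add: case_prod_unfold \<sigma>'_def xs'_def tab'_def cong: option.case_cong)
  then show ?case
    using 1 2 cost_lookup_entry[of D tab "hd xs ! i" i] by (simp add: algebra_simps)
qed simp


section \<open>Learning from a sample\<close>

text \<open>The pure effect of one iteration on the table, with costs and sampling stripped off, so
  that the random output becomes a fold over an independent list of examples.\<close>

definition learn_example :: "domain \<Rightarrow> nat \<Rightarrow> example \<Rightarrow> macro_table \<Rightarrow> macro_table" where
  "learn_example D n e tab = (case snd e of None \<Rightarrow> tab
     | Some \<sigma> \<Rightarrow> val D (parse_features (goal_state D) [0..<n]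
                    (val D (trajectory (fst e) \<sigma>)) \<sigma> tab))"

lemma learn_example_simps [simp]:
  "learn_example D n (x, None) tab = tab"
  "learn_example D n (x, Some \<sigma>) tab = val D (parse_features (goal_state D) [0..<n]
     (val D (trajectory x \<sigma>)) \<sigma> tab)"
  by (simp_all add: learn_example_def)

text \<open>The definition of \<open>run\<close> maps itself over all leaves of the program tree;
  only the leaf reached in \<open>D\<close> matters.\<close>

lemma run_Local: "run D E (Local p) = map_pmf (time_update (\<lambda>t. t + cost D p)) (run D E (val D p))"
  by (simp add: exec_map_prog)

declare run.simps(2) [simp del]

section \<open>Result, oracle calls and running time of the sampling loop\<close>

lemma run_map_learner:
  "run D E (map_learner h q) = map_pmf (\<lambda>w. \<lparr>result = h (result w), calls = calls w,
      time = time w, received = received w\<rparr>) (run D E q)"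
proof (induction q)
  case (Local p)
  then show ?case
    using val_in_set_prog[of D p]
    by (simp add: run_Local exec_map_prog pmf.map_comp o_def)
next
  case (Sample k)
  then show ?case
    by (simp add: map_bind_pmf pmf.map_comp o_def)
qed simp

text \<open>The draws are independent and everything else is deterministic, so all draws can be
  moved to the front.\<close>

lemma result_parse_examples:
  "map_pmf result (run D E (parse_examples n (goal_state D) m tab))
     = map_pmf (\<lambda>es. fold (learn_example D n) es tab) (replicate_pmf m E)"
proof (induction m arbitrary: tab)
  case 0
  show ?case by (simp add: run_Local)
next
  case (Suc m)
  have step: "map_pmf result (run D E (Local (do {
     tick;
     case r of
       None \<Rightarrow> Return (parse_examples n (goal_state D) m tab)
     | Some \<sigma> \<Rightarrow> do { xs \<leftarrow> trajectory x \<sigma>;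
                     tab' \<leftarrow> parse_features (goal_state D) [0..<n] xs \<sigma> tab;
                     Return (parse_examples n (goal_state D) m tab') } })))
    = map_pmf (\<lambda>es. fold (learn_example D n) es (learn_example D n (x, r) tab))
        (replicate_pmf m E)" for x r
    by (cases r) (simp_all add: run_Local pmf.map_comp comp_def[of result] Suc.IH)
  show ?case
    using step
    by (simp add: map_bind_pmf pmf.map_comp o_def case_prod_unfold map_pmf_def
        bind_assoc_pmf bind_return_pmf)
qed

lemma calls_parse_examples:
  "w \<in> set_pmf (run D E (parse_examples n g m tab)) \<Longrightarrow> calls w = m"
proof (induction m arbitrary: tab w)
  case (Suc m)
  from Suc.prems obtain x r w' where
    w': "w' \<in> set_pmf (run D E (Local (do {
     tick;
     case r of
       None \<Rightarrow> Return (parse_examples n g m tab)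
     | Some \<sigma> \<Rightarrow> do { xs \<leftarrow> trajectory x \<sigma>;
                     tab' \<leftarrow> parse_features g [0..<n] xs \<sigma> tab;
                     Return (parse_examples n g m tab') } })))"
    and w: "calls w = Suc (calls w')"
    by auto
  from w' have "calls w' = m"
    by (cases r) (auto simp: run_Local dest!: Suc.IH)
  with w show ?case by simp
qed (auto simp: run_Local)

lemma states_apply_op:
  "feature_domain n v D \<Longrightarrow> s \<in> states D \<Longrightarrow> a < num_ops D \<Longrightarrow> apply_op D a s \<in> states D"
  by (simp add: feature_domain_def)

lemma states_apply_ops:
  "feature_domain n v D \<Longrightarrow> s \<in> states D \<Longrightarrow> set \<sigma> \<subseteq> {..<num_ops D} \<Longrightarrow>
    apply_ops D \<sigma> s \<in> states D"
  by (induction \<sigma> arbitrary: s) (auto simp: states_apply_op)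

lemma cost_trajectory:
  assumes "feature_domain n v D" "time_bound D t" "s \<in> states D" "set \<sigma> \<subseteq> {..<num_ops D}"
  shows "cost D (trajectory s \<sigma>) \<le> length \<sigma> * (t + 3) + 1"
  using assms(3,4)
proof (induction \<sigma> arbitrary: s)
  case (Cons a \<sigma>)
  have "snd (op_proc D a s) \<le> t"
    using assms(2) Cons.prems by (simp add: time_bound_def)
  moreover have "cost D (trajectory (apply_op D a s) \<sigma>) \<le> length \<sigma> * (t + 3) + 1"
    using Cons assms(1) by (simp add: states_apply_op)
  ultimately show ?case by simp
qed simp

text \<open>Each operator of a received solution costs at most \<open>t + 3\<close> in the
  trajectory and \<open>n * (n + 3)\<close> in parsing, and is paid for by its unit in
  \<open>received w\<close>. The 4 per iteration is the oracle call, the tick after it and the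
  additive constants of \<open>cost_trajectory\<close> and
  \<open>cost_parse_features\<close>.\<close>

lemma time_parse_examples:
  assumes "feature_domain n v D" "time_bound D t"
    and E: "\<And>x \<sigma>. (x, Some \<sigma>) \<in> set_pmf E \<Longrightarrow> x \<in> states D \<and> set \<sigma> \<subseteq> {..<num_ops D}"
  shows "w \<in> set_pmf (run D E (parse_examples n g m tab)) \<Longrightarrow>
    time w \<le> 1 + m * (4 + n * (length tab + n * m + 2 * n + 6)) + received w * (t + 3 + n * (n + 3))"
proof (induction m arbitrary: tab w)
  case (Suc m)
  define c where "c = t + 3 + n * (n + 3)"
  from Suc.prems obtain x r w' where e: "(x, r) \<in> set_pmf E"
    and w': "w' \<in> set_pmf (run D E (Local (do {
     tick;
     case r of
       None \<Rightarrow> Return (parse_examples n g m tab)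
     | Some \<sigma> \<Rightarrow> do { xs \<leftarrow> trajectory x \<sigma>;
                     tab' \<leftarrow> parse_features g [0..<n] xs \<sigma> tab;
                     Return (parse_examples n g m tab') } })))"
    and w: "time w = Suc (time w')" "received w = received w' + example_length (x, r)"
    by auto
  let ?b = "\<lambda>l. m * (4 + n * (l + n * m + 2 * n + 6))"
  \<comment> \<open>One example adds at most \<open>n\<close> entries, for which the step from
    \<open>n * m\<close> to \<open>n * Suc m\<close> makes room.\<close>
  have mono: "?b l \<le> m * (4 + n * (length tab + n * Suc m + 2 * n + 6))" if "l \<le> length tab + n" for l
    using that by (intro mult_le_mono2 add_left_mono) simp
  show ?case
  proof (cases r)
    case None
    then obtain w'' where w'': "w'' \<in> set_pmf (run D E (parse_examples n g m tab))"
        "time w' = time w'' + 1" "received w' = received w''"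
      using w' by (auto simp: run_Local)
    have "time w'' \<le> 1 + ?b (length tab) + received w'' * c"
      using Suc.IH[OF w''(1)] by (simp add: c_def)
    moreover have "received w'' * c \<le> received w * c"
      using w'' w by simp
    ultimately show ?thesis
      unfolding c_def[symmetric] mult_Suc[of m] using mono[of "length tab"] w'' w by linarith
  next
    case (Some \<sigma>)
    define tab' where "tab' = val D (parse_features g [0..<n] (val D (trajectory x \<sigma>)) \<sigma> tab)"
    let ?p = "cost D (parse_features g [0..<n] (val D (trajectory x \<sigma>)) \<sigma> tab)"
    obtain w'' where w'': "w'' \<in> set_pmf (run D E (parse_examples n g m tab'))"
        "time w' = time w'' + (1 + cost D (trajectory x \<sigma>) + ?p)"
        "received w' = received w''"
      using w' by (auto simp: run_Local Some tab'_def)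
    have "?p \<le> n * (length \<sigma> * (n + 3) + length tab + n + n + 6) + 1"
      using cost_parse_features[of "[0..<n]" n D] by simp
    also have "\<dots> = length \<sigma> * (n * (n + 3)) + n * (length tab + 2 * n + 6) + 1"
      by (simp add: algebra_simps)
    also have "\<dots> \<le> length \<sigma> * (n * (n + 3)) + n * (length tab + n * Suc m + 2 * n + 6) + 1"
      by (intro add_mono mult_le_mono2) simp_all
    finally have p: "?p \<le> \<dots>" .
    have q: "cost D (trajectory x \<sigma>) \<le> length \<sigma> * (t + 3) + 1"
      using assms(1,2) E e Some by (intro cost_trajectory) blast+
    have "length tab' \<le> length tab + n"
      unfolding tab'_def by (rule order_trans[OF length_parse_features]) simp
    then have "time w'' \<le> 1 + m * (4 + n * (length tab + n * Suc m + 2 * n + 6)) + received w'' * c"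
      using Suc.IH[OF w''(1)] mono[of "length tab'"] unfolding c_def[symmetric] by linarith
    moreover have "received w'' * c + length \<sigma> * c \<le> received w * c"
      unfolding add_mult_distrib[symmetric] using w'' w Some by (intro mult_le_mono1) simp
    moreover have "length \<sigma> * c = length \<sigma> * (t + 3) + length \<sigma> * (n * (n + 3))"
      by (simp add: c_def add_mult_distrib2)
    ultimately show ?thesis
      unfolding c_def[symmetric] mult_Suc[of m] using p q w'' w by linarith
  qed
qed (auto simp: run_Local)


section \<open>Macro tables\<close>

text \<open>The solver without costs and without accumulator: it yields only the operators still to
  be appended, so inductions over the features can ignore the solution built so far.\<close>

primrec macro_solution :: "domain \<Rightarrow> macro_table \<Rightarrow> nat list \<Rightarrow> state \<Rightarrow> operator list option" where
  "macro_solution D tab [] s = (if is_goal D s then Some [] else None)"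
| "macro_solution D tab (i # js) s = (case entry tab (s ! i) i of None \<Rightarrow> None
     | Some mac \<Rightarrow> map_option ((@) mac) (macro_solution D tab js (apply_ops D mac s)))"

primrec used_keys :: "domain \<Rightarrow> macro_table \<Rightarrow> nat list \<Rightarrow> state \<Rightarrow> (nat \<times> nat) set" where
  "used_keys D tab [] s = {}"
| "used_keys D tab (i # js) s = insert (s ! i, i) (case entry tab (s ! i) i of None \<Rightarrow> {}
     | Some mac \<Rightarrow> used_keys D tab js (apply_ops D mac s))"

lemma val_solve_features:
  "val D (solve_features tab js s sol) = map_option ((@) sol) (macro_solution D tab js s)"
  by (induction js arbitrary: s sol) (auto simp: option.map_comp intro: option.map_cong split: option.split)

lemma answer_macro_problem_solver:
  "answer D (macro_problem_solver n tab) s = macro_solution D tab [0..<n] s"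
  by (cases "macro_solution D tab [0..<n] s")
    (simp_all add: answer_def macro_problem_solver_def val_solve_features)

lemma cost_apply_macro:
  assumes "feature_domain n v D" "time_bound D t" "s \<in> states D" "set mac \<subseteq> {..<num_ops D}"
  shows "cost D (apply_macro mac s) \<le> length mac * (t + 2) + 1"
  using assms(3,4)
proof (induction mac arbitrary: s)
  case (Cons a mac)
  have "snd (op_proc D a s) \<le> t"
    using assms(2) Cons.prems by (simp add: time_bound_def)
  moreover have "cost D (apply_macro mac (apply_op D a s)) \<le> length mac * (t + 2) + 1"
    using Cons assms(1) by (simp add: states_apply_op)
  ultimately show ?case by simp
qed simp

text \<open>Appending copies the solution built so far, whose length stays below
  \<open>length sol + length js * L\<close>; hence the quadratic dependence on the number of
  features. The 6 collects three ticks and the additive constants of lookup, append and macro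
  application.\<close>

lemma cost_solve_features:
  assumes D: "feature_domain n v D" "time_bound D t"
    and tab: "\<And>k mac. (k, mac) \<in> set tab \<Longrightarrow> set mac \<subseteq> {..<num_ops D} \<and> length mac \<le> L"
    and "s \<in> states D"
  shows "cost D (solve_features tab js s sol) \<le>
    length js * (length tab + 2 * (length sol + length js * L) + L * (t + 2) + 6) + t + 4"
  using \<open>s \<in> states D\<close>
proof (induction js arbitrary: s sol)
  case Nil
  then show ?case
    using D(2) by (auto simp: time_bound_def)
next
  case (Cons i js)
  let ?c = "length tab + 2 * (length sol + length (i # js) * L) + L * (t + 2) + 6"
  show ?case
  proof (cases "entry tab (s ! i) i")
    case None
    then show ?thesis
      using cost_lookup_entry[of D tab "s ! i" i] by simp
  next
    case (Some mac)
    then have mac: "set mac \<subseteq> {..<num_ops D}" "length mac \<le> L"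
      using tab by (auto dest!: map_of_SomeD)
    have "cost D (solve_features tab js (apply_ops D mac s) (sol @ mac)) \<le>
      length js * (length tab + 2 * (length (sol @ mac) + length js * L) + L * (t + 2) + 6) + t + 4"
      using Cons D mac by (intro Cons.IH) (simp add: states_apply_ops)
    also have "\<dots> \<le> length js * ?c + t + 4"
      using mac(2) by (intro add_right_mono mult_le_mono2) simp
    finally have 1: "cost D (solve_features tab js (apply_ops D mac s) (sol @ mac)) \<le> \<dots>" .
    have "cost D (apply_macro mac s) \<le> length mac * (t + 2) + 1"
      using D Cons.prems mac(1) by (rule cost_apply_macro)
    also have "\<dots> \<le> L * (t + 2) + 1"
      using mac(2) by (intro add_right_mono mult_le_mono1)
    finally have 2: "cost D (apply_macro mac s) \<le> \<dots>" .
    have "cost D (solve_features tab (i # js) s sol) = 4 + cost D (lookup_entry tab (s ! i) i)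
        + 2 * length sol + cost D (apply_macro mac s)
        + cost D (solve_features tab js (apply_ops D mac s) (sol @ mac))"
      by (simp add: Some)
    also have "\<dots> \<le> ?c + (length js * ?c + t + 4)"
      using 1 2 cost_lookup_entry[of D tab "s ! i" i] by simp
    finally show ?thesis by simp
  qed
qed

lemma hd_trajectory [simp]: "hd (val D (trajectory s \<sigma>)) = s"
  by (cases \<sigma>) simp_all

text \<open>The search stops at the first state passing the test. Induction peels off one operator,
  and a strict prefix of the tail becomes a strict prefix of the whole by putting that operator
  back.\<close>

lemma next_segment_trajectory:
  assumes "\<forall>k<i. apply_ops D mac s ! k = g ! k"
    and "\<And>mac'. strict_prefix mac' mac \<Longrightarrow> \<not> (\<forall>k<i. apply_ops D mac' s ! k = g ! k)"
  shows "val D (next_segment g i (val D (trajectory s (mac @ \<sigma>))) (mac @ \<sigma>))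
    = (mac, val D (trajectory (apply_ops D mac s) \<sigma>), \<sigma>)"
  using assms
proof (induction mac arbitrary: s)
  case Nil
  \<comment> \<open>With no operators left, \<open>next_segment\<close> returns the empty macro
    untested, the same result as after a successful test.\<close>
  then show ?case by (cases \<sigma>) simp_all
next
  case (Cons a mac)
  have "\<not> (\<forall>k<i. s ! k = g ! k)"
    using Cons.prems(2)[of "[]"] by simp
  moreover have "val D (next_segment g i (val D (trajectory (apply_op D a s) (mac @ \<sigma>))) (mac @ \<sigma>))
    = (mac, val D (trajectory (apply_ops D mac (apply_op D a s)) \<sigma>), \<sigma>)"
  proof (rule Cons.IH)
    show "\<not> (\<forall>k<i. apply_ops D mac' (apply_op D a s) ! k = g ! k)" if "strict_prefix mac' mac" for mac'
      using Cons.prems(2)[of "a # mac'"] that by simp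
  qed (use Cons.prems(1) in simp)
  ultimately show ?case
    by (simp add: case_prod_unfold del: not_all)
qed

section \<open>Serial decomposability and the target table\<close>

locale target_table =
  fixes D :: domain and n v :: nat and tgt :: macro_table
  assumes features: "feature_domain n v D"
    and serial: "serially_decomposable n D"
    and nonredundant: "nonredundant_table D n tgt"
begin

text \<open>Feature \<open>k < m\<close> of the result is a function of the features up to
  \<open>k\<close> of the argument, and these lie inside the common prefix.\<close>

lemma apply_op_prefix_cong:
  assumes "s \<in> states D" "s' \<in> states D" "a < num_ops D" "m \<le> n" "\<forall>k<m. s ! k = s' ! k"
  shows "\<forall>k<m. apply_op D a s ! k = apply_op D a s' ! k"
proof (intro allI impI)
  fix k assume "k < m"
  then have "k < n" using assms(4) by simp
  then obtain h where h: "\<And>s. s \<in> states D \<Longrightarrow> apply_op D a s ! k = h (take (Suc k) s)"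
    using serial assms(3) unfolding serially_decomposable_def by blast
  have "length s = n" "length s' = n"
    using features assms(1,2) by (auto simp: feature_domain_def)
  then have "take (Suc k) s = take (Suc k) s'"
    using assms(5) \<open>k < m\<close> by (intro nth_equalityI) auto
  then show "apply_op D a s ! k = apply_op D a s' ! k"
    using h assms(1,2) by simp
qed

lemma apply_ops_prefix_cong:
  assumes "s \<in> states D" "s' \<in> states D" "set \<sigma> \<subseteq> {..<num_ops D}" "m \<le> n" "\<forall>k<m. s ! k = s' ! k"
  shows "\<forall>k<m. apply_ops D \<sigma> s ! k = apply_ops D \<sigma> s' ! k"
  using assms(1,2,3,5)
proof (induction \<sigma> arbitrary: s s')
  case (Cons a \<sigma>)
  have "\<forall>k<m. apply_ops D \<sigma> (apply_op D a s) ! k = apply_ops D \<sigma> (apply_op D a s') ! k"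
    using Cons.prems assms(4) by (intro Cons.IH apply_op_prefix_cong)
      (auto intro: states_apply_op[OF features])
  then show ?case by simp
qed simp

lemma target_macro:
  assumes "s \<in> states D" "i < n" "entry tgt (s ! i) i = Some mac"
  shows "set mac \<subseteq> {..<num_ops D}" "nonredundant_macro D (s ! i) i mac"
  using nonredundant assms by (auto simp: nonredundant_table_def feature_values_def)

text \<open>The run ends with a goal test, and the target's macros consist of operators of
  \<open>D\<close>.\<close>

lemma macro_solution_solves:
  assumes "s \<in> states D" "set js \<subseteq> {..<n}" "macro_solution D tgt js s = Some \<sigma>"
  shows "solution_sequence D s \<sigma>"
  using assms
proof (induction js arbitrary: s \<sigma>)
  case (Cons i js)
  then obtain mac \<tau> where mac: "entry tgt (s ! i) i = Some mac"
    and \<tau>: "macro_solution D tgt js (apply_ops D mac s) = Some \<tau>" "\<sigma> = mac @ \<tau>"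
    by (auto split: option.splits)
  have "set mac \<subseteq> {..<num_ops D}"
    using target_macro(1)[OF _ _ mac] Cons.prems by simp
  then show ?case
    using Cons.IH[OF _ _ \<tau>(1)] Cons.prems \<tau>(2) states_apply_ops[OF features]
    by (auto simp: solution_sequence_def)
qed (auto simp: solution_sequence_def split: if_splits)

text \<open>By serial decomposability the effect of a macro on the first \<open>i + 1\<close> features is the same in all
  states to which a table entry applies, so a prefix that succeeds once always succeeds.\<close>

lemma no_early_success:
  assumes s: "s \<in> states D" "\<forall>k<i. s ! k = goal_state D ! k" and "i < n"
    and mac: "entry tgt (s ! i) i = Some mac" and "strict_prefix mac' mac"
  shows "\<not> (\<forall>k<Suc i. apply_ops D mac' s ! k = goal_state D ! k)"
proof
  assume *: "\<forall>k<Suc i. apply_ops D mac' s ! k = goal_state D ! k"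
  have "set mac' \<subseteq> {..<num_ops D}"
    using target_macro(1)[OF s(1) \<open>i < n\<close> mac] \<open>strict_prefix mac' mac\<close>
    by (meson order_trans set_mono_prefix strict_prefix_def)
  have "macro_table_property D (s ! i) i mac'"
    unfolding macro_table_property_def
  proof (intro ballI impI)
    fix s' assume "s' \<in> states D"
      and "solvable D s' \<and> (\<forall>k<i. s' ! k = goal_state D ! k) \<and> s' ! i = s ! i"
    then have "\<forall>k<Suc i. s' ! k = s ! k"
      using s(2) by (auto simp: less_Suc_eq)
    then have "\<forall>k<Suc i. apply_ops D mac' s' ! k = apply_ops D mac' s ! k"
      using \<open>s' \<in> states D\<close> s(1) \<open>set mac' \<subseteq> _\<close> \<open>i < n\<close> by (intro apply_ops_prefix_cong) auto
    then show "\<forall>k\<le>i. apply_ops D mac' s' ! k = goal_state D ! k"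
      using * by (simp add: less_Suc_eq_le)
  qed
  then show False
    using target_macro(2)[OF s(1) \<open>i < n\<close> mac] \<open>strict_prefix mac' mac\<close>
    by (simp add: nonredundant_macro_def)
qed

section \<open>Subtables of the target table\<close>

definition all_keys :: "(nat \<times> nat) set" where
  "all_keys = {(j, i). i < n \<and> j \<in> feature_values D i}"

text \<open>A restriction of the target table as an association list; distinct keys make its length
  the number of filled entries. The bound \<open>L\<close> is carried along because a target macro
  used on no solved problem may be longer than every solution.\<close>

definition subtable :: "nat \<Rightarrow> macro_table \<Rightarrow> bool" where
  "subtable L tab \<longleftrightarrow> distinct (map fst tab) \<and> fst ` set tab \<subseteq> all_keys \<and>
     (\<forall>(k, mac)\<in>set tab. map_of tgt k = Some mac \<and> length mac \<le> L)"

text \<open>Counted column by column. This count becomes the exponent of 2 in the union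
  bound.\<close>

lemma finite_all_keys: "finite all_keys" and card_all_keys: "card all_keys \<le> n * v"
proof -
  have fv: "finite (feature_values D i)" "card (feature_values D i) \<le> v" if "i < n" for i
    using features that by (auto simp: feature_domain_def)
  have eq: "all_keys = (\<Union>i<n. (\<lambda>j. (j, i)) ` feature_values D i)"
    by (auto simp: all_keys_def)
  show "finite all_keys"
    using fv by (auto simp: eq)
  have "card all_keys \<le> (\<Sum>i<n. card ((\<lambda>j. (j, i)) ` feature_values D i))"
    unfolding eq by (intro card_UN_le) simp
  also have "\<dots> \<le> (\<Sum>i<n. v)"
    using fv by (intro sum_mono) (auto simp: card_image inj_on_def)
  finally show "card all_keys \<le> n * v" by simp
qed

lemma length_subtable:
  assumes "subtable L tab"
  shows "length tab \<le> n * v"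
proof -
  have "length tab = card (fst ` set tab)"
    using assms distinct_card[of "map fst tab"] by (simp add: subtable_def)
  also have "\<dots> \<le> card all_keys"
    using assms by (intro card_mono finite_all_keys) (simp add: subtable_def)
  finally show ?thesis using card_all_keys by simp
qed

lemma subtable_macro:
  assumes "subtable L tab" "(k, mac) \<in> set tab"
  shows "set mac \<subseteq> {..<num_ops D} \<and> length mac \<le> L"
proof -
  obtain j i where [simp]: "k = (j, i)" by (cases k)
  have "(j, i) \<in> all_keys" "entry tgt j i = Some mac" "length mac \<le> L"
    using assms by (auto simp: subtable_def dest!: bspec[of _ _ "(k, mac)"])
  then show ?thesis
    using nonredundant by (auto simp: all_keys_def nonredundant_table_def)
qed

lemma entry_subtable:
  "subtable L tab \<Longrightarrow> entry tab j i = Some mac \<Longrightarrow> entry tgt j i = Some mac"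
  by (auto simp: subtable_def dest!: map_of_SomeD)

lemma used_keys_subset:
  "s \<in> states D \<Longrightarrow> set js \<subseteq> {..<n} \<Longrightarrow> used_keys D tgt js s \<subseteq> all_keys"
proof (induction js arbitrary: s)
  case (Cons i js)
  then show ?case
    using target_macro(1)[of s i] states_apply_ops[OF features]
    by (auto simp: all_keys_def feature_values_def split: option.splits)
qed simp

text \<open>Filled entries agree with the target's, so both runs pass through the same states until
  \<open>tab\<close> lacks an entry; there its run fails although the target's succeeds.\<close>

lemma macro_solution_subtable:
  assumes "subtable L tab" "macro_solution D tgt js s = Some \<sigma>"
  shows "macro_solution D tab js s = Some \<sigma> \<longleftrightarrow> used_keys D tgt js s \<subseteq> fst ` set tab"
  using assms(2)
proof (induction js arbitrary: s \<sigma>)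
  case (Cons i js)
  then obtain mac \<tau> where mac: "entry tgt (s ! i) i = Some mac"
    and \<tau>: "macro_solution D tgt js (apply_ops D mac s) = Some \<tau>" "\<sigma> = mac @ \<tau>"
    by (auto split: option.splits)
  show ?case
  proof (cases "entry tab (s ! i) i")
    case None
    then have "(s ! i, i) \<notin> fst ` set tab"
      by (simp add: map_of_eq_None_iff)
    with None show ?thesis by simp
  next
    case (Some mac')
    then have "mac' = mac"
      using entry_subtable[OF assms(1) Some] mac by simp
    moreover have "(s ! i, i) \<in> fst ` set tab"
      using Some by (force dest: map_of_SomeD)
    ultimately show ?thesis
      using Some mac Cons.IH[OF \<tau>(1)] \<tau>(2) by auto
  qed
qed simp

text \<open>Induction from \<open>i = n\<close> downwards. The cut at feature \<open>i\<close>
  reproduces the target's macro, so a new entry is the target's entry, and what remains of the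
  trajectory is again a run of the target, now with \<open>Suc i\<close> features at their goal
  values.\<close>

lemma parse_features_subtable:
  assumes "i \<le> n" "s \<in> states D" "\<forall>k<i. s ! k = goal_state D ! k"
    and "macro_solution D tgt [i..<n] s = Some \<sigma>" "length \<sigma> \<le> L" "subtable L tab"
  defines "tab' \<equiv> val D (parse_features (goal_state D) [i..<n] (val D (trajectory s \<sigma>)) \<sigma> tab)"
  shows "subtable L tab' \<and> fst ` set tab' = fst ` set tab \<union> used_keys D tgt [i..<n] s"
  using assms(1-6) unfolding tab'_def
proof (induction i arbitrary: s \<sigma> tab rule: inc_induct)
  case base
  then show ?case by simp
next
  case (step i)
  let ?g = "goal_state D"
  have i: "[i..<n] = i # [Suc i..<n]"
    using step.hyps by (simp add: upt_conv_Cons)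
  from step.prems obtain mac \<tau> where mac: "entry tgt (s ! i) i = Some mac"
    and \<tau>: "macro_solution D tgt [Suc i..<n] (apply_ops D mac s) = Some \<tau>" "\<sigma> = mac @ \<tau>"
    by (auto simp: i split: option.splits)
  note mac_ops = target_macro[OF step.prems(1) step.hyps(2) mac]
  \<comment> \<open>The macro-table property speaks of solvable states only; the target's own
    solution shows that \<open>s\<close> is one.\<close>
  have "solution_sequence D s \<sigma>"
    using step.prems by (intro macro_solution_solves[where js = "[i..<n]"]) auto
  then have "solvable D s"
    by (auto simp: solvable_def)
  then have success: "\<forall>k<Suc i. apply_ops D mac s ! k = ?g ! k"
    using mac_ops(2) step.prems unfolding nonredundant_macro_def macro_table_property_def
    by (simp add: less_Suc_eq_le)
  have seg: "val D (next_segment ?g (Suc i) (val D (trajectory s \<sigma>)) \<sigma>)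
      = (mac, val D (trajectory (apply_ops D mac s) \<tau>), \<tau>)"
    unfolding \<tau>(2) using success no_early_success[OF step.prems(1,2) step.hyps(2) mac]
    by (intro next_segment_trajectory) auto
  define tab'' where "tab'' = (case entry tab (s ! i) i of None \<Rightarrow> ((s ! i, i), mac) # tab | Some _ \<Rightarrow> tab)"
  have key: "(s ! i, i) \<in> all_keys"
    using step.prems step.hyps by (auto simp: all_keys_def feature_values_def)
  have keys: "fst ` set tab'' = insert (s ! i, i) (fst ` set tab)"
    by (force simp: tab''_def split: option.split dest: map_of_SomeD)
  \<comment> \<open>An entry filled earlier already holds \<open>mac\<close>; a new one is a piece
    of \<open>\<sigma>\<close>, so its length is at most \<open>L\<close>.\<close>
  have "subtable L tab''"
    using step.prems(5) key mac step.prems(4) \<tau>(2)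
    by (auto simp: tab''_def subtable_def map_of_eq_None_iff split: option.split)
  moreover have "apply_ops D mac s \<in> states D"
    using states_apply_ops[OF features] step.prems mac_ops by simp
  ultimately show ?case
    using step.IH[OF _ success \<tau>(1), of tab''] step.prems(4) \<tau>(2) keys mac
    by (simp add: i seg[unfolded \<tau>(2)] tab''_def cong: option.case_cong)
qed

section \<open>Entries needed by a problem and learned from a sample\<close>

abbreviation target_solver :: solver where
  "target_solver \<equiv> macro_problem_solver n tgt"

text \<open>The set is empty on unsolved problems because they teach no entries and
  \<open>disagreement\<close> does not count them.\<close>

definition needed :: "state \<Rightarrow> (nat \<times> nat) set" where
  "needed x = (if answer D target_solver x = None then {} else used_keys D tgt [0..<n] x)"

lemma needed_subset: "x \<in> states D \<Longrightarrow> needed x \<subseteq> all_keys"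
  using used_keys_subset[of x "[0..<n]"] by (auto simp: needed_def lessThan_atLeast0)

text \<open>States are lists of length \<open>n\<close> over a finite set of values. Finiteness
  makes the maximum in \<open>max_solution_length\<close> meaningful and turns the sum over the
  disagreement set into a probability.\<close>

lemma finite_states: "finite (states D)"
proof (rule finite_subset)
  have "xs \<in> states D \<Longrightarrow> x \<in> set xs \<Longrightarrow> \<exists>i<n. x \<in> feature_values D i" for xs x
    using features by (force simp: feature_domain_def feature_values_def in_set_conv_nth)
  then show "states D \<subseteq> {xs. set xs \<subseteq> (\<Union>i<n. feature_values D i) \<and> length xs = n}"
    using features by (fastforce simp: feature_domain_def)
  show "finite {xs. set xs \<subseteq> (\<Union>i<n. feature_values D i) \<and> length xs = n}"
    using features by (intro finite_lists_length_eq) (auto simp: feature_domain_def)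
qed

lemma length_le_max_solution_length:
  assumes "x \<in> states D" "answer D f x = Some \<sigma>"
  shows "length \<sigma> \<le> max_solution_length D f"
proof -
  have "{length \<sigma> | s \<sigma>. s \<in> states D \<and> answer D f s = Some \<sigma>}
      \<subseteq> (\<lambda>s. length (the (answer D f s))) ` states D"
    by force
  then have "finite {length \<sigma> | s \<sigma>. s \<in> states D \<and> answer D f s = Some \<sigma>}"
    using finite_states finite_surj by blast
  then show ?thesis
    unfolding max_solution_length_def using assms by (intro Max_ge) auto
qed

lemma learn_example_subtable:
  assumes "x \<in> states D" "subtable (max_solution_length D target_solver) tab"
  defines "tab' \<equiv> learn_example D n (x, answer D target_solver x) tab"
  shows "subtable (max_solution_length D target_solver) tab' \<and> fst ` set tab' = fst ` set tab \<union> needed x"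
proof (cases "answer D target_solver x")
  case None
  then show ?thesis using assms by (simp add: needed_def)
next
  case (Some \<sigma>)
  then show ?thesis
    unfolding tab'_def using assms length_le_max_solution_length[OF assms(1) Some]
      parse_features_subtable[of 0 x \<sigma>]
    by (simp add: needed_def answer_macro_problem_solver)
qed

lemma learn_sample_subtable:
  assumes "set xs \<subseteq> states D" "subtable (max_solution_length D target_solver) tab"
  defines "tab' \<equiv> fold (learn_example D n) (map (\<lambda>x. (x, answer D target_solver x)) xs) tab"
  shows "subtable (max_solution_length D target_solver) tab' \<and>
    fst ` set tab' = fst ` set tab \<union> (\<Union>x\<in>set xs. needed x)"
  using assms(1,2) unfolding tab'_def
proof (induction xs arbitrary: tab)
  case (Cons x xs)
  then show ?case
    using learn_example_subtable[of x tab] by auto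
qed simp

lemma disagreement_subtable:
  assumes "subtable L tab"
  shows "disagreement D target_solver (macro_problem_solver n tab)
    = {x \<in> states D. \<not> needed x \<subseteq> fst ` set tab}"
  using macro_solution_subtable[OF assms]
  by (force simp: disagreement_def needed_def answer_macro_problem_solver)

lemma approximates_subtable:
  assumes "subtable L tab" "measure_pmf.prob P {x. \<not> needed x \<subseteq> fst ` set tab} \<le> \<epsilon>"
  shows "approximates D P \<epsilon> target_solver (macro_problem_solver n tab)"
proof -
  let ?A = "{x \<in> states D. \<not> needed x \<subseteq> fst ` set tab}"
  have "(\<Sum>x\<in>?A. pmf P x) = measure_pmf.prob P ?A"
    using finite_states by (simp add: measure_measure_pmf_finite)
  also have "\<dots> \<le> measure_pmf.prob P {x. \<not> needed x \<subseteq> fst ` set tab}"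
    by (intro measure_pmf.finite_measure_mono) auto
  finally show ?thesis
    using assms by (simp add: approximates_def disagreement_subtable)
qed

end


section \<open>Sample complexity\<close>

text \<open>Independence of the draws, split off one draw at a time.\<close>

lemma prob_replicate_pmf_subset:
  "measure_pmf.prob (replicate_pmf m P) {xs. set xs \<subseteq> A} = measure_pmf.prob P A ^ m"
proof (induction m)
  case (Suc m)
  have "emeasure (replicate_pmf (Suc m) P) {xs. set xs \<subseteq> A}
      = (\<integral>\<^sup>+x. emeasure (replicate_pmf m P) {xs. x \<in> A \<and> set xs \<subseteq> A} \<partial>P)"
    by (simp add: map_pmf_def[symmetric] vimage_def)
  \<comment> \<open>Membership of the first draw in \<open>A\<close> becomes an indicator factor, so
    the integral splits into a product.\<close>
  also have "\<dots> = (\<integral>\<^sup>+x. emeasure (replicate_pmf m P) {xs. set xs \<subseteq> A} * indicator A x \<partial>P)"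
    by (intro nn_integral_cong) (auto simp: indicator_def)
  also have "\<dots> = emeasure (replicate_pmf m P) {xs. set xs \<subseteq> A} * emeasure P A"
    by (simp add: nn_integral_cmult_indicator)
  finally show ?case
    by (simp add: measure_def Suc.IH[unfolded measure_def] enn2real_mult mult.commute)
qed simp

lemma replicate_pmf_map: "replicate_pmf m (map_pmf h P) = map_pmf (map h) (replicate_pmf m P)"
  by (induction m) (simp_all add: map_pmf_def bind_assoc_pmf bind_return_pmf)

text \<open>The covered set depends on the sample, so the union runs over all fixed candidates
  \<open>K\<close> of large error: a sample covering exactly \<open>K\<close> consists of problems
  whose needs lie inside \<open>K\<close>, an event with probability below
  \<open>1 - \<epsilon>\<close> in each draw.\<close>

lemma coverage_bound:
  fixes need :: "'a \<Rightarrow> 'b set"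
  assumes U: "finite U" "\<And>x. x \<in> set_pmf P \<Longrightarrow> need x \<subseteq> U" and "\<epsilon> \<le> 1"
  shows "measure_pmf.prob (replicate_pmf m P)
      {xs. \<epsilon> < measure_pmf.prob P {x. \<not> need x \<subseteq> (\<Union>y\<in>set xs. need y)}} \<le> 2 ^ card U * (1 - \<epsilon>) ^ m"
proof -
  let ?p = "measure_pmf.prob (replicate_pmf m P)"
  let ?bad = "{xs. \<epsilon> < measure_pmf.prob P {x. \<not> need x \<subseteq> (\<Union>y\<in>set xs. need y)}}"
  let ?err = "\<lambda>K. measure_pmf.prob P {x. \<not> need x \<subseteq> K}"
  define I where "I = {K \<in> Pow U. \<epsilon> < ?err K}"
  have "finite I" using U by (simp add: I_def)
  have compl: "measure_pmf.prob P {x. need x \<subseteq> K} = 1 - ?err K" for K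
    using measure_pmf.prob_compl[of "{x. \<not> need x \<subseteq> K}" P]
    by (simp add: Compl_eq_Diff_UNIV[symmetric] Collect_neg_eq[symmetric])
  \<comment> \<open>Only draws from the support of \<open>P\<close> are known to have their needs
    inside \<open>U\<close>.\<close>
  have "?p ?bad = ?p (?bad \<inter> set_pmf (replicate_pmf m P))"
    by (simp add: measure_Int_set_pmf)
  also have "\<dots> \<le> ?p (\<Union>K\<in>I. {xs. set xs \<subseteq> {x. need x \<subseteq> K}})"
  proof (intro measure_pmf.finite_measure_mono subsetI)
    fix xs assume "xs \<in> ?bad \<inter> set_pmf (replicate_pmf m P)"
    then have "(\<Union>y\<in>set xs. need y) \<in> I"
      using U(2) by (auto simp: I_def set_replicate_pmf lists_eq_set)
    then show "xs \<in> (\<Union>K\<in>I. {xs. set xs \<subseteq> {x. need x \<subseteq> K}})"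
      by blast
  qed simp
  also have "\<dots> \<le> (\<Sum>K\<in>I. ?p {xs. set xs \<subseteq> {x. need x \<subseteq> K}})"
    using \<open>finite I\<close> by (intro measure_UNION_le) simp_all
  also have "\<dots> = (\<Sum>K\<in>I. (1 - ?err K) ^ m)"
    by (simp add: prob_replicate_pmf_subset compl)
  also have "\<dots> \<le> (\<Sum>K\<in>I. (1 - \<epsilon>) ^ m)"
    by (intro sum_mono power_mono) (auto simp: I_def)
  also have "\<dots> = card I * (1 - \<epsilon>) ^ m"
    by simp
  also have "\<dots> \<le> 2 ^ card U * (1 - \<epsilon>) ^ m"
  proof (intro mult_right_mono)
    have "card I \<le> 2 ^ card U"
      using U(1) card_mono[of "Pow U" I] by (auto simp: I_def card_Pow)
    then show "real (card I) \<le> 2 ^ card U"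
      by (metis of_nat_le_iff of_nat_numeral of_nat_power)
  qed (use \<open>\<epsilon> \<le> 1\<close> in simp)
  finally show ?thesis .
qed

text \<open>Since \<open>1 - \<epsilon> \<le> exp (- \<epsilon>)\<close>, the left side is at most
  the exponential of \<open>n * v * ln 2 - \<epsilon> * m\<close>, and the sample size
  \<open>m\<close> pushes this exponent down to \<open>ln \<delta>\<close>.\<close>

lemma sample_size_suffices:
  assumes "0 < \<epsilon>" "\<epsilon> < 1" "0 < \<delta>" "k \<le> n * v"
  shows "2 ^ k * (1 - \<epsilon>) ^ sample_size n v \<epsilon> \<delta> \<le> \<delta>"
proof -
  let ?m = "sample_size n v \<epsilon> \<delta>"
  have "1 / \<epsilon> * (real n * real v * ln 2 + ln (1 / \<delta>)) \<le> real ?m"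
    unfolding sample_size_def by (rule real_nat_ceiling_ge)
  then have m: "real n * real v * ln 2 + ln (1 / \<delta>) \<le> \<epsilon> * real ?m"
    using assms(1) by (simp add: field_simps)
  have "(1 - \<epsilon>) ^ ?m \<le> exp (- \<epsilon>) ^ ?m"
    using assms exp_ge_add_one_self[of "- \<epsilon>"] by (intro power_mono) simp_all
  also have "\<dots> = exp (- (\<epsilon> * real ?m))"
    by (simp add: exp_of_nat_mult[symmetric] mult.commute)
  finally have 1: "(1 - \<epsilon>) ^ ?m \<le> exp (- (\<epsilon> * real ?m))" .
  have "(2::real) ^ k \<le> 2 ^ (n * v)"
    using assms by (intro power_increasing) simp_all
  also have "\<dots> = exp (real n * real v * ln 2)"
    using exp_of_nat_mult[of "n * v" "ln 2 :: real"] by simp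
  finally have "2 ^ k * (1 - \<epsilon>) ^ ?m \<le> exp (real n * real v * ln 2) * exp (- (\<epsilon> * real ?m))"
    using 1 assms by (intro mult_mono) simp_all
  also have "\<dots> \<le> exp (ln \<delta>)"
    unfolding exp_add[symmetric] exp_le_cancel_iff using m assms by (simp add: ln_div)
  also have "\<dots> = \<delta>" using assms by simp
  finally show ?thesis .
qed

text \<open>The logarithm is traded for \<open>1 / \<delta>\<close> to obtain a polynomial bound;
  the final 1 pays for rounding up.\<close>

lemma sample_size_le:
  assumes "0 < \<epsilon>" "0 < \<delta>" "\<delta> < 1" "real v \<le> q"
  shows "real (sample_size n v \<epsilon> \<delta>) \<le> 1 / \<epsilon> * (real n * q * ln 2 + 1 / \<delta>) + 1"
proof -
  let ?x = "1 / \<epsilon> * (real n * real v * ln 2 + ln (1 / \<delta>))"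
  \<comment> \<open>For a nonnegative argument \<open>nat\<close> leaves the rounded value
    unchanged.\<close>
  have "0 \<le> ?x" using assms by (intro mult_nonneg_nonneg add_nonneg_nonneg) simp_all
  then have "real (sample_size n v \<epsilon> \<delta>) \<le> ?x + 1"
    unfolding sample_size_def by linarith
  also have "?x \<le> 1 / \<epsilon> * (real n * q * ln 2 + 1 / \<delta>)"
    using assms ln_le_minus_one[of "1 / \<delta>"]
    by (intro mult_left_mono add_mono mult_right_mono) simp_all
  finally show ?thesis by simp
qed

section \<open>Serial-parser\<close>

lemma set_run_serial_parser:
  assumes "w \<in> set_pmf (run D E (serial_parser l g n v \<epsilon> \<delta>))"
  obtains w' where "w' \<in> set_pmf (run D E (parse_examples n g (sample_size n v \<epsilon> \<delta>) []))"
    "result w = macro_problem_solver n (result w')" "calls w = calls w'"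
    "time w = time w' + 1" "received w = received w'"
  using assms by (auto simp: serial_parser_def run_Local run_map_learner)

lemma result_serial_parser:
  "map_pmf result (run D (solved_problem D P f) (serial_parser l (goal_state D) n v \<epsilon> \<delta>)) =
    map_pmf (\<lambda>xs. macro_problem_solver n
        (fold (learn_example D n) (map (\<lambda>x. (x, answer D f x)) xs) []))
      (replicate_pmf (sample_size n v \<epsilon> \<delta>) P)"
proof -
  have "map_pmf result (run D (solved_problem D P f) (serial_parser l (goal_state D) n v \<epsilon> \<delta>))
    = map_pmf (macro_problem_solver n) (map_pmf result (run D (solved_problem D P f)
        (parse_examples n (goal_state D) (sample_size n v \<epsilon> \<delta>) [])))"
    by (simp add: serial_parser_def run_Local run_map_learner pmf.map_comp o_def)
  then show ?thesis
    by (simp add: result_parse_examples solved_problem_def replicate_pmf_map pmf.map_comp o_def)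
qed

context target_table
begin

context
  fixes P :: "state pmf" and \<epsilon> \<delta> :: real
  assumes P: "set_pmf P \<subseteq> states D"
begin

abbreviation runs :: "solver outcome pmf" where
  "runs \<equiv> run D (solved_problem D P target_solver)
     (serial_parser (num_ops D) (goal_state D) n v \<epsilon> \<delta>)"

lemma calls_serial_parser: "w \<in> set_pmf runs \<Longrightarrow> calls w = sample_size n v \<epsilon> \<delta>"
  by (auto elim!: set_run_serial_parser dest: calls_parse_examples)

text \<open>The loop starts with the empty table; one unit of the 2 is the tick charged for the
  sample size.\<close>

lemma time_serial_parser:
  assumes "time_bound D t" "w \<in> set_pmf runs"
  shows "time w \<le> 2 + sample_size n v \<epsilon> \<delta> * (4 + n * (n * sample_size n v \<epsilon> \<delta> + 2 * n + 6))
    + received w * (t + 3 + n * (n + 3))"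
proof -
  \<comment> \<open>The target's answers are solution sequences, so the bound \<open>t\<close>
    applies to every operator that the parser replays.\<close>
  have "x \<in> states D \<and> set \<sigma> \<subseteq> {..<num_ops D}"
    if "(x, Some \<sigma>) \<in> set_pmf (solved_problem D P target_solver)" for x \<sigma>
  proof -
    have x: "x \<in> states D" "macro_solution D tgt [0..<n] x = Some \<sigma>"
      using that P by (auto simp: solved_problem_def answer_macro_problem_solver)
    then have "solution_sequence D x \<sigma>"
      by (intro macro_solution_solves[where js = "[0..<n]"]) auto
    with x show ?thesis by (simp add: solution_sequence_def)
  qed
  from time_parse_examples[OF features assms(1) this] show ?thesis
    using assms(2) by (elim set_run_serial_parser) fastforce
qed

text \<open>The running time of the output has to be bounded for every possible sample, not just
  with high probability.\<close>

lemma result_serial_parser_subtable: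
  assumes "w \<in> set_pmf runs"
  obtains tab where "result w = macro_problem_solver n tab"
    "subtable (max_solution_length D target_solver) tab"
proof -
  have "result w \<in> set_pmf (map_pmf result runs)"
    using assms by simp
  then obtain xs where "set xs \<subseteq> states D" "result w = macro_problem_solver n
        (fold (learn_example D n) (map (\<lambda>x. (x, answer D target_solver x)) xs) [])"
    using P unfolding result_serial_parser by (auto simp: set_replicate_pmf)
  then show ?thesis
    using learn_sample_subtable[of xs "[]"] by (intro that) (auto simp: subtable_def)
qed

lemma run_time_serial_parser:
  assumes "time_bound D t" "w \<in> set_pmf runs" "x \<in> states D"
  defines "L \<equiv> max_solution_length D target_solver"
  shows "run_time D (result w) x \<le> n * (n * v + 2 * (n * L) + L * (t + 2) + 6) + t + 4"
proof -
  obtain tab where tab: "result w = macro_problem_solver n tab" "subtable L tab"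
    using result_serial_parser_subtable[OF assms(2)] unfolding L_def by blast
  have "run_time D (result w) x \<le> n * (length tab + 2 * (n * L) + L * (t + 2) + 6) + t + 4"
    using cost_solve_features[OF features assms(1) _ assms(3), where js = "[0..<n]" and sol = "[]"]
      subtable_macro[OF tab(2)]
    by (simp add: tab(1) run_time_def macro_problem_solver_def)
  also have "\<dots> \<le> n * (n * v + 2 * (n * L) + L * (t + 2) + 6) + t + 4"
    using length_subtable[OF tab(2)] by (intro add_right_mono mult_le_mono2)
  finally show ?thesis .
qed

lemma prob_approximates_serial_parser:
  assumes "0 < \<epsilon>" "\<epsilon> < 1" "0 < \<delta>"
  shows "1 - \<delta> \<le> measure_pmf.prob runs {w. approximates D P \<epsilon> target_solver (result w)}"
proof -
  let ?S = "replicate_pmf (sample_size n v \<epsilon> \<delta>) P"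
  let ?tab = "\<lambda>xs. fold (learn_example D n) (map (\<lambda>x. (x, answer D target_solver x)) xs) []"
  let ?bad = "{xs. \<epsilon> < measure_pmf.prob P {x. \<not> needed x \<subseteq> (\<Union>y\<in>set xs. needed y)}}"
  have good: "approximates D P \<epsilon> target_solver (macro_problem_solver n (?tab xs))"
    if "xs \<in> set_pmf ?S" "xs \<notin> ?bad" for xs
  proof -
    have "subtable (max_solution_length D target_solver) (?tab xs)"
      "fst ` set (?tab xs) = (\<Union>x\<in>set xs. needed x)"
      using learn_sample_subtable[of xs "[]"] that(1) P
      by (auto simp: set_replicate_pmf subtable_def)
    then show ?thesis
      using that(2) by (intro approximates_subtable) auto
  qed
  \<comment> \<open>\<open>all_keys\<close> takes the role of \<open>U\<close>; its size is at most
    the product \<open>n * v\<close> built into the sample size.\<close>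
  have "measure_pmf.prob ?S ?bad \<le> 2 ^ card all_keys * (1 - \<epsilon>) ^ sample_size n v \<epsilon> \<delta>"
    using P needed_subset assms by (intro coverage_bound finite_all_keys) auto
  also have "\<dots> \<le> \<delta>"
    using assms card_all_keys by (intro sample_size_suffices)
  finally have "1 - \<delta> \<le> measure_pmf.prob ?S (- ?bad)"
    using measure_pmf.prob_compl[of ?bad ?S] by (simp add: Compl_eq_Diff_UNIV)
  \<comment> \<open>On the support all sampled problems are states, as \<open>good\<close>
    requires.\<close>
  also have "\<dots> = measure_pmf.prob ?S (- ?bad \<inter> set_pmf ?S)"
    by (simp add: measure_Int_set_pmf)
  also have "\<dots> \<le> measure_pmf.prob ?S
      {xs. approximates D P \<epsilon> target_solver (macro_problem_solver n (?tab xs))}"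
    using good by (intro measure_pmf.finite_measure_mono) auto
  also have "\<dots> = measure_pmf.prob (map_pmf result runs) {f. approximates D P \<epsilon> target_solver f}"
    by (simp add: result_serial_parser vimage_def)
  finally show ?thesis
    by (simp add: vimage_def)
qed

end

end

theorem theorem4:
  fixes M :: "nat \<Rightarrow> domain set" and H :: "nat \<Rightarrow> (domain \<times> solver) set" and v :: "nat \<Rightarrow> nat"
  assumes "\<And>n. meta_domain n (v n) (M n)"
    and "\<And>n D. D \<in> M n \<Longrightarrow> serially_decomposable n D"
    and "\<And>n. H n = nonredundant_macro_solvers n (M n)"
    and "\<exists>p. real_polynomial_function p \<and> (\<forall>n. real (v n) \<le> p (real n))"
  shows "speedup_learning_algorithm serial_parser v M H"
proof -
  obtain p where p: "real_polynomial_function p" and v: "\<And>n. real (v n) \<le> p (real n)"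
    using assms(4) by blast
  \<comment> \<open>The bound of \<open>sample_size_le\<close>, with \<open>e\<close> and
    \<open>d\<close> for \<open>1 / \<epsilon>\<close> and \<open>1 / \<delta>\<close> and with the
    polynomial \<open>p\<close> for the number of values.\<close>
  define B where "B n e d = e * (n * p n * ln 2 + d) + 1" for n e d :: real
  define C :: "real \<times> real \<times> real \<times> real \<Rightarrow> real"
    where "C = (\<lambda>x. B (fst x) (fst (snd x)) (fst (snd (snd x))))"
  \<comment> \<open>\<open>T\<close> and \<open>R\<close> copy the bounds of
    \<open>time_serial_parser\<close> and \<open>run_time_serial_parser\<close>, with
    \<open>B\<close> for the sample size and \<open>p\<close> for the number of values.\<close>
  define T :: "real \<times> real \<times> real \<times> real \<times> real \<Rightarrow> real" where
    "T = (\<lambda>x. let n = fst x; b = B n (fst (snd x)) (fst (snd (snd x)));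
           l = fst (snd (snd (snd x))); t = snd (snd (snd (snd x)))
       in 2 + b * (4 + n * (n * b + 2 * n + 6)) + l * (t + 3 + n * (n + 3)))"
  define R :: "real \<times> real \<times> real \<times> real \<times> real \<Rightarrow> real" where
    "R = (\<lambda>x. let n = fst x; L = fst (snd x); t = fst (snd (snd x))
       in n * (n * p n + 2 * (n * L) + L * (t + 2) + 6) + t + 4)"
  \<comment> \<open>\<open>p\<close> is univariate while \<open>C\<close>, \<open>T\<close> and
    \<open>R\<close> take tuples, so \<open>p\<close> is composed with a projection. After the
    closure rules only projections remain, and these are bounded linear.\<close>
  have "real_polynomial_function (\<lambda>x. p (q x))" if "real_polynomial_function q"
    for q :: "'z :: euclidean_space \<Rightarrow> real"
    using real_polynomial_function_compose[of q p] that p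
    by (simp add: real_polynomial_function_eq o_def)
  note poly_intros = real_polynomial_function.intros(2-4) this
  have "real_polynomial_function C"
    unfolding C_def B_def
    by (intro poly_intros; intro real_polynomial_function.intros(1) bounded_linear_intros)
  moreover have "real_polynomial_function T"
    unfolding T_def B_def Let_def
    by (intro poly_intros; intro real_polynomial_function.intros(1) bounded_linear_intros)
  moreover have "real_polynomial_function R"
    unfolding R_def Let_def
    by (intro poly_intros; intro real_polynomial_function.intros(1) bounded_linear_intros)
  moreover have "let runs = run D (solved_problem D P f)
                (serial_parser (num_ops D) (goal_state D) n (v n) \<epsilon> \<delta>);
             L = max_solution_length D f
         in (\<forall>w\<in>set_pmf runs. real (calls w) \<le> C (real n, 1 / \<epsilon>, 1 / \<delta>, real (input_length D))) \<and>
            (\<forall>t. time_bound D t \<longrightarrow> (\<forall>w\<in>set_pmf runs.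
               real (time w)
                 \<le> T (real n, 1 / \<epsilon>, 1 / \<delta>, real (input_length D + received w), real t))) \<and>
            measure_pmf.prob runs {w. approximates D P \<epsilon> f (result w)} \<ge> 1 - \<delta> \<and>
            (\<forall>t. time_bound D t \<longrightarrow> (\<forall>w\<in>set_pmf runs. \<forall>x\<in>states D.
               real (run_time D (result w) x)
                 \<le> R (real n, real L, real t, 1 / \<epsilon>, 1 / \<delta>)))"
    if "D \<in> M n" and P: "set_pmf P \<subseteq> states D" and "(D, f) \<in> H n"
      and \<epsilon>: "0 < \<epsilon>" "\<epsilon> < 1" and \<delta>: "0 < \<delta>" "\<delta> < 1" for n D P f \<epsilon> \<delta>
  proof -
    obtain tgt where "nonredundant_table D n tgt" and f: "f = macro_problem_solver n tgt"
      using \<open>(D, f) \<in> H n\<close> assms(3) by (auto simp: nonredundant_macro_solvers_def based_on_def)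
    then interpret target_table D n "v n" tgt
      using assms(1,2) \<open>D \<in> M n\<close> by unfold_locales (auto simp: meta_domain_def)
    let ?m = "sample_size n (v n) \<epsilon> \<delta>"
    let ?b = "B (real n) (1 / \<epsilon>) (1 / \<delta>)"
    have m: "real ?m \<le> ?b"
      using sample_size_le[OF \<epsilon>(1) \<delta> v] unfolding B_def .
    have T: "real (time w) \<le> T (real n, 1 / \<epsilon>, 1 / \<delta>, real (input_length D + received w), real t)"
      if "time_bound D t" "w \<in> set_pmf (runs P \<epsilon> \<delta>)" for t w
    proof -
      have "real (time w) \<le> real (2 + ?m * (4 + n * (n * ?m + 2 * n + 6))
          + received w * (t + 3 + n * (n + 3)))"
        using time_serial_parser[OF P that] by (rule of_nat_mono)
      also have "\<dots> = 2 + real ?m * (4 + real n * (real n * real ?m + 2 * real n + 6))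
          + real (received w) * (real t + 3 + real n * (real n + 3))"
        by simp
      \<comment> \<open>Monotonicity of the products needs \<open>?b\<close> to be nonnegative,
        which follows from \<open>m\<close>.\<close>
      also have "\<dots> \<le> 2 + ?b * (4 + real n * (real n * ?b + 2 * real n + 6))
          + real (input_length D + received w) * (real t + 3 + real n * (real n + 3))"
        using m order_trans[OF of_nat_0_le_iff m]
        by (intro add_mono mult_mono mult_left_mono mult_right_mono order_refl) simp_all
      finally show ?thesis by (simp add: T_def Let_def)
    qed
    have R: "real (run_time D (result w) x)
        \<le> R (real n, real (max_solution_length D target_solver), real t, 1 / \<epsilon>, 1 / \<delta>)"
      if "time_bound D t" "w \<in> set_pmf (runs P \<epsilon> \<delta>)" "x \<in> states D" for t w x
    proof -
      let ?L = "max_solution_length D target_solver"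
      have "real (run_time D (result w) x)
          \<le> real (n * (n * v n + 2 * (n * ?L) + ?L * (t + 2) + 6) + t + 4)"
        using run_time_serial_parser[OF P that] by (rule of_nat_mono)
      also have "\<dots> = real n * (real n * real (v n) + 2 * (real n * real ?L)
          + real ?L * (real t + 2) + 6) + real t + 4"
        by (simp add: distrib_left)
      also have "\<dots> \<le> real n * (real n * p (real n) + 2 * (real n * real ?L)
          + real ?L * (real t + 2) + 6) + real t + 4"
        using v by (intro add_mono mult_left_mono order_refl) simp_all
      finally show ?thesis by (simp add: R_def Let_def)
    qed
    show ?thesis
      unfolding f Let_def
      using m T R calls_serial_parser[OF P] prob_approximates_serial_parser[OF P \<epsilon> \<delta>(1)]
      by (simp add: C_def)
  qed
  ultimately show ?thesis
    unfolding speedup_learning_algorithm_def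
    by (intro exI[of _ C] exI[of _ T] exI[of _ R] conjI allI ballI impI) assumption+
qed

end
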